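(* Let $n$ be a positive integer, let $T = e_1 T_1 + e_2 T_2 \in L_1^{n}\times_e L_1^{n}$, where $T_1,T_2$ are $\mathbb{C}_1$-linear operators on $\mathbb{C}_1^n$, and let $\mathcal{B}_1$ be an ordered basis of $\mathbb{C}_1^n$. Put $A^- = [T_1]_{\mathcal{B}_1}$ and $A^+ = [T_2]_{\mathcal{B}_1}$. Then $T$ is a $\mathbb{C}_2$-nilpotent operator if and only if $A = e_1 A^- + e_2 A^+$ is a $\mathbb{C}_2$-nilpotent matrix.
   Context: $\mathbb{C}_1$ is the field of complex numbers (imaginary unit $i_1$). The bicomplex numbers are $\mathbb{C}_2 = \{z_1 + i_2 z_2 : z_1,z_2\in\mathbb{C}_1\}$, a commutative ring with $i_1^2=i_2^2=-1$ and $i_1 i_2 = i_2 i_1$. Put $e_1 = (1+i_1 i_2)/2$ and $e_2 = (1-i_1 i_2)/2$; these satisfy $e_1^2=e_1$, $e_2^2=e_2$, $e_1e_2=0$, $e_1+e_2=1$. Every $\xi = z_1+i_2 z_2\in\mathbb{C}_2$ is written uniquely as $\xi = \xi^- e_1 + \xi^+ e_2$ with $\xi^- = z_1 - i_1 z_2$ and $\xi^+ = z_1 + i_1 z_2$ in $\mathbb{C}_1$. For $\mathbb{C}_1$-linear operators $T_1,T_2$ on $\mathbb{C}_1^n$, the $\mathbb{C}_1$-linear operator $e_1T_1+e_2T_2:\mathbb{C}_2^n\to\mathbb{C}_2^n$ is defined by $$(e_1T_1+e_2T_2)(\xi_1,\dots,\xi_n) = e_1\cdot T_1(\xi_1^-,\dots,\xi_n^-)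 + e_2\cdot T_2(\xi_1^+,\dots,\xi_n^+).$$ The set of all such operators is denoted $L_1^n\times_e L_1^n$. An operator $T\in L_1^n\times_e L_1^n$ is called $\mathbb{C}_2$-nilpotent if $T^k=0$ (the $k$-fold composition) for some positive integer $k$. $[T_j]_{\mathcal{B}_1}$ denotes the (complex $n\times n$) matrix of $T_j$ with respect to $\mathcal{B}_1$. A matrix $A\in\mathbb{C}_2^{n\times n}$ (an $n\times n$ matrix with bicomplex entries) is called $\mathbb{C}_2$-nilpotent if $A^k=0$ for some positive integer $k$; matrices over $\mathbb{C}_2$ are multiplied and scaled in the usual way. *)

theory Defs
  imports "HOL-Analysis.Analysis"
begin

datatype bicomplex = Bicomplex (bc_fst: complex) (bc_snd: complex)
  (* Bicomplex z1 z2 stands for z1 + i2 z2. *)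

instantiation bicomplex :: comm_ring_1
begin

definition "0 = Bicomplex 0 0"
definition "1 = Bicomplex 1 0"
definition "x + y = Bicomplex (bc_fst x + bc_fst y) (bc_snd x + bc_snd y)"
definition "- x = Bicomplex (- bc_fst x) (- bc_snd x)"
definition "x - y = Bicomplex (bc_fst x - bc_fst y) (bc_snd x - bc_snd y)"
definition "x * y = Bicomplex (bc_fst x * bc_fst y - bc_snd x * bc_snd y)
                              (bc_fst x * bc_snd y + bc_snd x * bc_fst y)"

instance
  by standard
    (auto simp: zero_bicomplex_def one_bicomplex_def plus_bicomplex_def uminus_bicomplex_def
      minus_bicomplex_def times_bicomplex_def algebra_simps intro: bicomplex.expand)

end

lemmas bicomplex_defs = zero_bicomplex_def one_bicomplex_def plus_bicomplex_def
  uminus_bicomplex_def minus_bicomplex_def times_bicomplex_def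

definition bc_of_complex :: "complex \<Rightarrow> bicomplex" where
  "bc_of_complex z = Bicomplex z 0"

definition bc_i1 :: bicomplex where
  "bc_i1 = bc_of_complex \<i>"

definition bc_i2 :: bicomplex where
  "bc_i2 = Bicomplex 0 1"

definition bc_e1 :: bicomplex where
  "bc_e1 = bc_of_complex (1/2) * (1 + bc_i1 * bc_i2)"

definition bc_e2 :: bicomplex where
  "bc_e2 = bc_of_complex (1/2) * (1 - bc_i1 * bc_i2)"

definition bc_minus :: "bicomplex \<Rightarrow> complex" where
  "bc_minus \<xi> = bc_fst \<xi> - \<i> * bc_snd \<xi>"

definition bc_plus :: "bicomplex \<Rightarrow> complex" where
  "bc_plus \<xi> = bc_fst \<xi> + \<i> * bc_snd \<xi>"

lemma bicomplex_eq: "\<xi> = bc_of_complex (bc_fst \<xi>) + bc_i2 * bc_of_complex (bc_snd \<xi>)"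
  by (simp add: bicomplex_defs bc_of_complex_def bc_i2_def)

lemma bc_units:
  "bc_i1 * bc_i1 = - 1" "bc_i2 * bc_i2 = - 1"
  by (simp_all add: bicomplex_defs bc_of_complex_def bc_i1_def bc_i2_def)

lemma bc_idempotents:
  "bc_e1 * bc_e1 = bc_e1" "bc_e2 * bc_e2 = bc_e2" "bc_e1 * bc_e2 = 0" "bc_e1 + bc_e2 = 1"
  by (simp_all add: bicomplex_defs bc_of_complex_def bc_i1_def bc_i2_def bc_e1_def bc_e2_def)

lemma bc_idempotent_decomp:
  "\<xi> = bc_of_complex (bc_minus \<xi>) * bc_e1 + bc_of_complex (bc_plus \<xi>) * bc_e2"
  by (cases \<xi>) (simp add: bicomplex_defs bc_of_complex_def bc_i1_def bc_i2_def bc_e1_def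
      bc_e2_def bc_minus_def bc_plus_def field_simps)

definition bc_vec :: "complex ^ 'n \<Rightarrow> bicomplex ^ 'n" where
  "bc_vec v = (\<chi> i. bc_of_complex (v $ i))"

definition e_op ::
  "(complex ^ 'n \<Rightarrow> complex ^ 'n) \<Rightarrow> (complex ^ 'n \<Rightarrow> complex ^ 'n) \<Rightarrow> bicomplex ^ 'n \<Rightarrow> bicomplex ^ 'n"
where
  "e_op T1 T2 \<xi> = bc_e1 *s bc_vec (T1 (\<chi> j. bc_minus (\<xi> $ j)))
                + bc_e2 *s bc_vec (T2 (\<chi> j. bc_plus (\<xi> $ j)))"

(* Vector_Spaces.linear with respect to *s is linearity over the complex numbers;
   the unqualified linear would only be linearity over the reals. *)
definition L1 :: "(complex ^ 'n \<Rightarrow> complex ^ 'n) set" where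
  "L1 = {T. Vector_Spaces.linear (*s) (*s) T}"

definition L1_e_prod :: "(bicomplex ^ 'n \<Rightarrow> bicomplex ^ 'n) set" where
  "L1_e_prod = {e_op T1 T2 | T1 T2. T1 \<in> L1 \<and> T2 \<in> L1}"

definition C2_nilpotent_op :: "(bicomplex ^ 'n \<Rightarrow> bicomplex ^ 'n) \<Rightarrow> bool" where
  "C2_nilpotent_op T \<longleftrightarrow> T \<in> L1_e_prod \<and> (\<exists>k>0. T ^^ k = (\<lambda>_. 0))"

primrec mat_power :: "'a::semiring_1 ^ 'n ^ 'n \<Rightarrow> nat \<Rightarrow> 'a ^ 'n ^ 'n" where
  "mat_power A 0 = mat 1"
| "mat_power A (Suc k) = A ** mat_power A k"

definition C2_nilpotent_mat :: "bicomplex ^ 'n ^ 'n \<Rightarrow> bool" where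
  "C2_nilpotent_mat A \<longleftrightarrow> (\<exists>k>0. mat_power A k = 0)"

definition e_mat :: "complex ^ 'n ^ 'n \<Rightarrow> complex ^ 'n ^ 'n \<Rightarrow> bicomplex ^ 'n ^ 'n" where
  "e_mat A B = (\<chi> i j. bc_e1 * bc_of_complex (A $ i $ j) + bc_e2 * bc_of_complex (B $ i $ j))"

(* An ordered basis is a family of vectors indexed by the same type as the coordinates. *)
definition ordered_basis :: "('n \<Rightarrow> complex ^ 'n) \<Rightarrow> bool" where
  "ordered_basis b \<longleftrightarrow> inj b \<and> vec.independent (range b) \<and> vec.span (range b) = UNIV"

(* The j-th column consists of the coordinates of T (b j) with respect to b. *)
definition matrix_wrt ::
  "('n \<Rightarrow> complex ^ 'n) \<Rightarrow> (complex ^ 'n \<Rightarrow> complex ^ 'n) \<Rightarrow> complex ^ 'n ^ 'n" where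
  "matrix_wrt b T = (\<chi> i j. vec.representation (range b) (T (b j)) (b i))"

end

theory Submission
  imports Defs
begin

text \<open>
  The maps \<open>\<xi> \<mapsto> \<xi>\<^sup>-\<close> and \<open>\<xi> \<mapsto> \<xi>\<^sup>+\<close> are ring homomorphisms that jointly identify the bicomplex numbers
  with two copies of the complex numbers, so powers of operators and of matrices are formed
  componentwise. In each component, passing to the matrix with respect to a basis turns composition
  into matrix multiplication and is injective on linear maps. Hence the same exponents annihilate
  the operator and the matrix.
\<close>

text \<open>The idempotent decomposition rebuilds an element from its two components, so bicomplex
  identities below reduce to pairs of complex ones.\<close>

lemma bicomplex_eq_iff: "x = y \<longleftrightarrow> bc_minus x = bc_minus y \<and> bc_plus x = bc_plus y"
  using bc_idempotent_decomp[of x] bc_idempotent_decomp[of y] by metis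

lemma bc_minus_simps [simp]:
  "bc_minus 0 = 0" "bc_minus 1 = 1" "bc_minus (x + y) = bc_minus x + bc_minus y"
  "bc_minus (x * y) = bc_minus x * bc_minus y"
  "bc_minus (bc_of_complex z) = z" "bc_minus bc_e1 = 1" "bc_minus bc_e2 = 0"
  by (simp_all add: bicomplex_defs bc_minus_def bc_of_complex_def bc_e1_def bc_e2_def bc_i1_def
      bc_i2_def algebra_simps)

lemma bc_plus_simps [simp]:
  "bc_plus 0 = 0" "bc_plus 1 = 1" "bc_plus (x + y) = bc_plus x + bc_plus y"
  "bc_plus (x * y) = bc_plus x * bc_plus y"
  "bc_plus (bc_of_complex z) = z" "bc_plus bc_e1 = 0" "bc_plus bc_e2 = 1"
  by (simp_all add: bicomplex_defs bc_plus_def bc_of_complex_def bc_e1_def bc_e2_def bc_i1_def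
      bc_i2_def algebra_simps)

lemma bc_minus_sum [simp]: "bc_minus (sum f I) = (\<Sum>i\<in>I. bc_minus (f i))"
  by (induction I rule: infinite_finite_induct) auto

lemma bc_plus_sum [simp]: "bc_plus (sum f I) = (\<Sum>i\<in>I. bc_plus (f i))"
  by (induction I rule: infinite_finite_induct) auto

lemma bc_minus_e_op [simp]: "bc_minus (e_op S T \<xi> $ i) = S (\<chi> j. bc_minus (\<xi> $ j)) $ i"
  by (simp add: e_op_def bc_vec_def)

lemma bc_plus_e_op [simp]: "bc_plus (e_op S T \<xi> $ i) = T (\<chi> j. bc_plus (\<xi> $ j)) $ i"
  by (simp add: e_op_def bc_vec_def)

text \<open>Each component of the output depends only on the same component of the input, so the two
  never mix under iteration.\<close>

lemma e_op_funpow: "e_op S T ^^ k = e_op (S ^^ k) (T ^^ k)"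
  by (induction k) (auto simp: fun_eq_iff vec_eq_iff bicomplex_eq_iff)

lemma e_op_eq_0_iff: "e_op S T = (\<lambda>_. 0) \<longleftrightarrow> S = (\<lambda>_. 0) \<and> T = (\<lambda>_. 0)"
proof
  assume *: "e_op S T = (\<lambda>_. 0)"
  have "S v $ i = 0 \<and> T v $ i = 0" for v i
    \<comment> \<open>Both components of \<open>bc_vec v\<close> equal \<open>v\<close>, so this one
      argument tests \<open>S\<close> and \<open>T\<close> together.\<close>
    using bc_minus_e_op[of S T "bc_vec v" i] bc_plus_e_op[of S T "bc_vec v" i]
    by (simp add: * bc_vec_def)
  then show "S = (\<lambda>_. 0) \<and> T = (\<lambda>_. 0)"
    by (simp add: fun_eq_iff vec_eq_iff)
qed (auto simp: fun_eq_iff vec_eq_iff bicomplex_eq_iff)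

lemma e_mat_mult: "e_mat A B ** e_mat C D = e_mat (A ** C) (B ** D)"
  by (simp add: vec_eq_iff bicomplex_eq_iff e_mat_def matrix_matrix_mult_def)

lemma e_mat_mat_1: "e_mat (mat 1) (mat 1) = mat 1"
  by (simp add: vec_eq_iff bicomplex_eq_iff e_mat_def mat_def)

lemma e_mat_power: "mat_power (e_mat A B) k = e_mat (mat_power A k) (mat_power B k)"
  by (induction k) (simp_all add: e_mat_mat_1 e_mat_mult)

lemma e_mat_eq_0_iff: "e_mat A B = 0 \<longleftrightarrow> A = 0 \<and> B = 0"
  by (auto simp: vec_eq_iff bicomplex_eq_iff e_mat_def)

lemma sum_representation_ordered_basis:
  assumes "ordered_basis b"
  shows "(\<Sum>j\<in>UNIV. vec.representation (range b) v (b j) *s b j) = v"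
proof -
  have "(\<Sum>w\<in>range b. vec.representation (range b) v w *s w) = v"
    using assms by (intro vec.sum_representation_eq) (auto simp: ordered_basis_def)
  then show ?thesis
    using assms by (simp add: sum.reindex ordered_basis_def)
qed

text \<open>Expand \<open>v\<close> in the basis, apply \<open>S\<close> termwise and read off
  coordinates. Both multiplicativity and injectivity of \<open>matrix_wrt b\<close> rest on
  this.\<close>

lemma representation_linear_image:
  assumes b: "ordered_basis b" and S: "S \<in> L1"
  shows "vec.representation (range b) (S v) (b i) =
    (\<Sum>j\<in>UNIV. matrix_wrt b S $ i $ j * vec.representation (range b) v (b j))"
proof -
  interpret S: Vector_Spaces.linear "(*s)" "(*s)" S
    using S by (simp add: L1_def)
  have ind: "vec.independent (range b)" and span: "\<And>u. u \<in> vec.span (range b)"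
    using b by (auto simp: ordered_basis_def)
  have "S v = (\<Sum>j\<in>UNIV. vec.representation (range b) v (b j) *s S (b j))"
    \<comment> \<open>Only the argument of \<open>S\<close> is expanded; the \<open>v\<close> inside
      the coefficients stays.\<close>
    by (subst sum_representation_ordered_basis[OF b, of v, symmetric])
      (simp only: S.sum S.scale)
  then show ?thesis
    by (simp add: vec.representation_sum[OF ind] vec.representation_scale[OF ind] span
        matrix_wrt_def mult.commute)
qed

lemma matrix_wrt_comp:
  assumes "ordered_basis b" and "S \<in> L1"
  shows "matrix_wrt b (S \<circ> T) = matrix_wrt b S ** matrix_wrt b T"
proof -
  have "matrix_wrt b (S \<circ> T) $ i $ j = (matrix_wrt b S ** matrix_wrt b T) $ i $ j" for i j
    \<comment> \<open>The coordinates of \<open>T (b j)\<close> form column \<open>j\<close> of the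
      matrix of \<open>T\<close>.\<close>
    using representation_linear_image[OF assms, of "T (b j)" i]
    by (simp add: matrix_matrix_mult_def matrix_wrt_def)
  then show ?thesis
    by (simp add: vec_eq_iff)
qed

lemma matrix_wrt_id:
  assumes "ordered_basis b"
  shows "matrix_wrt b id = mat 1"
proof -
  have "vec.representation (range b) (b j) = (\<lambda>w. if w = b j then 1 else 0)" for j
    using assms by (intro vec.representation_basis) (auto simp: ordered_basis_def)
  \<comment> \<open>Injectivity of \<open>b\<close> turns \<open>b i = b j\<close> into
    \<open>i = j\<close>, giving the identity matrix.\<close>
  then show ?thesis
    using assms by (simp add: matrix_wrt_def mat_def ordered_basis_def inj_eq)
qed

lemma matrix_wrt_funpow:
  assumes "ordered_basis b" and "S \<in> L1"
  shows "matrix_wrt b (S ^^ k) = mat_power (matrix_wrt b S) k"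
  by (induction k) (simp_all only: funpow.simps mat_power.simps matrix_wrt_id matrix_wrt_comp assms)

lemma matrix_wrt_eq_0_iff:
  assumes b: "ordered_basis b" and S: "S \<in> L1"
  shows "matrix_wrt b S = 0 \<longleftrightarrow> S = (\<lambda>_. 0)"
proof
  assume "matrix_wrt b S = 0"
  then have "vec.representation (range b) (S v) (b i) = 0" for v i
    by (simp add: representation_linear_image[OF b S])
  then have "S v = 0" for v
    using sum_representation_ordered_basis[OF b, of "S v"] by simp
  then show "S = (\<lambda>_. 0)" by blast
next
  assume "S = (\<lambda>_. 0)"
  then show "matrix_wrt b S = 0"
    by (simp add: vec_eq_iff matrix_wrt_def fun_cong[OF vec.representation_zero])
qed

text \<open>This lets \<open>matrix_wrt_eq_0_iff\<close> be applied to powers of an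
  operator.\<close>

lemma L1_funpow:
  assumes "S \<in> L1"
  shows "S ^^ k \<in> L1"
proof (induction k)
  case 0
  show ?case by (simp only: funpow.simps L1_def mem_Collect_eq vec.linear_id)
next
  case (Suc k)
  then show ?case
    using assms by (simp only: funpow.simps L1_def mem_Collect_eq Vector_Spaces.linear_compose)
qed

theorem theorem3p4:
  fixes T1 T2 :: "complex ^ 'n \<Rightarrow> complex ^ 'n"
    and T :: "bicomplex ^ 'n \<Rightarrow> bicomplex ^ 'n"
    and B1 :: "'n \<Rightarrow> complex ^ 'n"
    and Am Ap :: "complex ^ 'n ^ 'n"
    and A :: "bicomplex ^ 'n ^ 'n"
  assumes "T1 \<in> L1" and "T2 \<in> L1"
    and "T = e_op T1 T2"
    and "ordered_basis B1"
    and "Am = matrix_wrt B1 T1" and "Ap = matrix_wrt B1 T2"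
    and "A = e_mat Am Ap"
  shows "C2_nilpotent_op T \<longleftrightarrow> C2_nilpotent_mat A"
proof -
  have "mat_power (matrix_wrt B1 S) k = 0 \<longleftrightarrow> S ^^ k = (\<lambda>_. 0)" if "S \<in> L1" for S k
    using matrix_wrt_eq_0_iff[OF \<open>ordered_basis B1\<close> L1_funpow[OF that]]
      matrix_wrt_funpow[OF \<open>ordered_basis B1\<close> that] by simp
  \<comment> \<open>Each side vanishes exactly when both of its components do, and these are
    compared at the same \<open>k\<close>.\<close>
  then have "T ^^ k = (\<lambda>_. 0) \<longleftrightarrow> mat_power A k = 0" for k
    using assms by (simp add: e_op_funpow e_op_eq_0_iff e_mat_power e_mat_eq_0_iff)
  moreover have "T \<in> L1_e_prod"
    using assms by (auto simp: L1_e_prod_def)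
  ultimately show ?thesis
    by (simp add: C2_nilpotent_op_def C2_nilpotent_mat_def)
qed

end
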